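(* Let $(X,d)$ be a compact metric space and let $f_n: X\to X$ be continuous for each $n\geq 0$. Assume that the system $x_{n+1}=f_n(x_n)$, $n\ge0$, has two periodic points whose orbits do not intersect each other. If the system has the asymptotic average shadowing property, then it is distributionally $\delta$-chaotic for some $\delta>0$.
   Context: For maps $f_n:X\to X$ ($n\ge0$), $f_0^0$ is the identity map on $X$ and $f_0^n:=f_{n-1}\circ\cdots\circ f_0$ for $n\ge1$. The orbit of $x\in X$ is $\{f_0^n(x)\}_{n=0}^\infty$. A point $x\in X$ is periodic if there is an integer $k\ge1$ with $f_0^{n+k}(x)=f_0^n(x)$ for all $n\ge0$. Two orbits do not intersect each other if they are disjoint as subsets of $X$. A sequence $\{x_n\}_{n=0}^\infty\subset X$ is an asymptotic average pseudo-orbit of the system if $\lim_{n\to\infty}\frac1n\sum_{i=0}^{n-1}d(f_i(x_i),x_{i+1})=0$. It is asymptotically shadowed in average by a point $y_0\in X$ if $\lim_{n\to\infty}\frac1n\sum_{i=0}^{n-1}d(f_0^i(y_0),x_i)=0$. The system has the asymptotic average shadowing property if every asymptotic average pseudo-orbit of the system is asymptotically shadowed in average by some point of $X$. For $x,y\in X$ and $\epsilon>0$, set $$F^*_{x,y}(\epsilon)=\limsup_{n\to\infty}\frac1n\sum_{i=0}^{n-1}\chi_{[0,\epsilon)}\big(d(f_0^{i}(x),f_0^{i}(y))\big),\qquad F_{x,y}(\epsilon)=\liminf_{n\to\infty}\frac1n\sum_{i=0}^{n-1}\chi_{[0,\epsilon)}\big(d(f_0^{i}(x),f_0^{i}(y))\big),$$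 where $\chi_{[0,\epsilon)}$ is the characteristic function of $[0,\epsilon)$. Let $\delta>0$. A set $D\subset X$ with at least two points is a distributionally $\delta$-scrambled set if for all $x,y\in D$ with $x\ne y$: $F^*_{x,y}(\epsilon)=1$ for every $\epsilon>0$, and $F_{x,y}(\delta)=0$. The system is distributionally $\delta$-chaotic if it has an uncountable distributionally $\delta$-scrambled set. *)

theory Defs
  imports "HOL-Analysis.Analysis"
begin

text \<open>The phase space is a set \<open>X\<close> in an ambient metric space, with the induced metric. The maps
  \<open>f n\<close> are total functions of the ambient type, of which only the restrictions to \<open>X\<close> matter;
  that they map \<open>X\<close> to \<open>X\<close> is a hypothesis wherever it is needed.\<close>

primrec comp_maps :: "(nat \<Rightarrow> 'a \<Rightarrow> 'a) \<Rightarrow> nat \<Rightarrow> 'a \<Rightarrow> 'a" where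
  "comp_maps f 0 = id"
| "comp_maps f (Suc n) = f n \<circ> comp_maps f n"

definition sys_orbit :: "(nat \<Rightarrow> 'a \<Rightarrow> 'a) \<Rightarrow> 'a \<Rightarrow> 'a set" where
  "sys_orbit f x = range (\<lambda>n. comp_maps f n x)"

definition periodic_point :: "'a set \<Rightarrow> (nat \<Rightarrow> 'a \<Rightarrow> 'a) \<Rightarrow> 'a \<Rightarrow> bool" where
  "periodic_point X f x \<longleftrightarrow>
     x \<in> X \<and> (\<exists>k\<ge>1. \<forall>n. comp_maps f (n + k) x = comp_maps f n x)"

definition asymp_avg_pseudo_orbit ::
    "'a::metric_space set \<Rightarrow> (nat \<Rightarrow> 'a \<Rightarrow> 'a) \<Rightarrow> (nat \<Rightarrow> 'a) \<Rightarrow> bool" where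
  "asymp_avg_pseudo_orbit X f x \<longleftrightarrow>
     (\<forall>n. x n \<in> X) \<and>
     (\<lambda>n. 1 / real n * (\<Sum>i<n. dist (f i (x i)) (x (Suc i)))) \<longlonglongrightarrow> 0"

definition asymp_shadowed_in_avg ::
    "(nat \<Rightarrow> 'a::metric_space \<Rightarrow> 'a) \<Rightarrow> (nat \<Rightarrow> 'a) \<Rightarrow> 'a \<Rightarrow> bool" where
  "asymp_shadowed_in_avg f x y \<longleftrightarrow>
     (\<lambda>n. 1 / real n * (\<Sum>i<n. dist (comp_maps f i y) (x i))) \<longlonglongrightarrow> 0"

definition asymp_avg_shadowing_property ::
    "'a::metric_space set \<Rightarrow> (nat \<Rightarrow> 'a \<Rightarrow> 'a) \<Rightarrow> bool" where
  "asymp_avg_shadowing_property X f \<longleftrightarrow>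
     (\<forall>x. asymp_avg_pseudo_orbit X f x \<longrightarrow> (\<exists>y\<in>X. asymp_shadowed_in_avg f x y))"

definition close_freq ::
    "(nat \<Rightarrow> 'a::metric_space \<Rightarrow> 'a) \<Rightarrow> 'a \<Rightarrow> 'a \<Rightarrow> real \<Rightarrow> nat \<Rightarrow> real" where
  "close_freq f x y \<epsilon> n =
     1 / real n * (\<Sum>i<n. indicator {0..<\<epsilon>} (dist (comp_maps f i x) (comp_maps f i y)))"

text \<open>The frequencies lie in the unit interval; they are cast to \<^typ>\<open>ereal\<close> only because
  \<^const>\<open>limsup\<close> and \<^const>\<open>liminf\<close> need a complete lattice.\<close>

definition upper_dist_fun ::
    "(nat \<Rightarrow> 'a::metric_space \<Rightarrow> 'a) \<Rightarrow> 'a \<Rightarrow> 'a \<Rightarrow> real \<Rightarrow> ereal" where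
  "upper_dist_fun f x y \<epsilon> = limsup (\<lambda>n. ereal (close_freq f x y \<epsilon> n))"

definition lower_dist_fun ::
    "(nat \<Rightarrow> 'a::metric_space \<Rightarrow> 'a) \<Rightarrow> 'a \<Rightarrow> 'a \<Rightarrow> real \<Rightarrow> ereal" where
  "lower_dist_fun f x y \<epsilon> = liminf (\<lambda>n. ereal (close_freq f x y \<epsilon> n))"

definition dist_scrambled ::
    "'a::metric_space set \<Rightarrow> (nat \<Rightarrow> 'a \<Rightarrow> 'a) \<Rightarrow> real \<Rightarrow> 'a set \<Rightarrow> bool" where
  "dist_scrambled X f \<delta> D \<longleftrightarrow>
     D \<subseteq> X \<and> (\<exists>x\<in>D. \<exists>y\<in>D. x \<noteq> y) \<and>
     (\<forall>x\<in>D. \<forall>y\<in>D. x \<noteq> y \<longrightarrow>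
        (\<forall>\<epsilon>>0. upper_dist_fun f x y \<epsilon> = 1) \<and> lower_dist_fun f x y \<delta> = 0)"

definition dist_chaotic :: "'a::metric_space set \<Rightarrow> (nat \<Rightarrow> 'a \<Rightarrow> 'a) \<Rightarrow> real \<Rightarrow> bool" where
  "dist_chaotic X f \<delta> \<longleftrightarrow> (\<exists>D. uncountable D \<and> dist_scrambled X f \<delta> D)"

end

theory Submission
  imports Defs
begin

text \<open>
  Orbits of the two periodic points \<open>p\<close> and \<open>q\<close> are finite and disjoint, hence a positive distance
  apart. Cut time into the blocks \<open>[k!, (k+1)!)\<close> and follow, throughout each block, either the orbit
  of \<open>p\<close> or the orbit of \<open>q\<close>. Such a sequence errs only when it switches orbits, at most once per
  block; the number of blocks begun before time \<open>n\<close> is \<open>o(n)\<close>, so every choice of orbits gives an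
  asymptotic average pseudo-orbit (lemma \<open>avg_error_of_orbit_switching\<close>), which some true orbit
  shadows in average.

  Two features of the blocks make the shadowing orbits scrambled. A block is so much longer than all
  its predecessors together that averages up to its end depend only on what happens in it; and the
  shadowing errors tend to \<open>0\<close> in average, so by Markov's inequality they are small at most times.
  Hence at the end of a late block the shadowing orbits of two choices are close most of the time if
  the choices agree in that block, and apart most of the time if they differ
  (lemma \<open>avg_tendsto_0_at_block_ends\<close>). It remains to name uncountably many choices any two of
  which agree in infinitely many blocks and differ in infinitely many blocks. The choices are indexed
  by sets of naturals: all follow \<open>q\<close> in the even-numbered blocks, and the odd-numbered blocks query
  membership of each natural infinitely often.
\<close>

section \<open>Blocks of factorial length\<close>

abbreviation avg :: "(nat \<Rightarrow> real) \<Rightarrow> nat \<Rightarrow> real" where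
  "avg u n \<equiv> 1 / real n * (\<Sum>i<n. u i)"

text \<open>Block \<open>0\<close> is empty because \<open>0! = 1!\<close> would make it end where block \<open>1\<close> starts; time \<open>0\<close>,
  which precedes \<open>0!\<close>, is therefore assigned to it.\<close>

definition block :: "nat \<Rightarrow> nat" where
  "block n = (LEAST k. n < fact (Suc k))"

lemma less_fact_Suc_block: "n < fact (Suc (block n))"
proof -
  have "n < fact (Suc n)"
    by (meson Suc_le_lessD fact_ge_self)
  then show ?thesis
    unfolding block_def by (rule LeastI)
qed

lemma block_le: "n < fact (Suc k) \<Longrightarrow> block n \<le> k"
  unfolding block_def by (rule Least_le)

lemma fact_block_le: "block n > 0 \<Longrightarrow> fact (block n) \<le> n"
  using block_le[of n "block n - 1"] by (cases "n < fact (block n)") auto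

lemma block_eq:
  assumes "fact k \<le> n" "n < fact (Suc k)"
  shows "block n = k"
proof (rule antisym)
  show "block n \<le> k"
    using assms(2) by (rule block_le)
  have "fact k < (fact (Suc (block n)) :: nat)"
    using assms(1) less_fact_Suc_block by (rule le_less_trans)
  then show "k \<le> block n"
    by (metis fact_mono_nat not_less_eq_eq not_le)
qed

lemma block_mono: "m \<le> n \<Longrightarrow> block m \<le> block n"
  using less_fact_Suc_block[of n] by (intro block_le) simp

lemma filterlim_block: "filterlim block at_top sequentially"
  unfolding filterlim_at_top eventually_sequentially
proof (intro allI exI impI)
  fix k n :: nat assume "fact k \<le> n"
  then have "block (fact k) \<le> block n"
    by (rule block_mono)
  moreover have "block (fact k) \<ge> k"
    by (metis fact_mono_nat less_fact_Suc_block not_less not_less_eq_eq)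
  ultimately show "k \<le> block n" by simp
qed

text \<open>Since \<open>n \<ge> k!\<close> for \<open>n\<close> in block \<open>k\<close>, the ratio is at most \<open>k / k!\<close>.\<close>

lemma block_over_time_tendsto_0: "(\<lambda>n. real (block n) / real n) \<longlonglongrightarrow> 0"
proof -
  have "(\<lambda>k. real k / fact k) \<longlonglongrightarrow> 0"
  proof (rule LIMSEQ_imp_Suc)
    have "(\<lambda>k. inverse (fact k) * 1 ^ k :: real) \<longlonglongrightarrow> 0"
      by (intro summable_LIMSEQ_zero summable_exp)
    also have "(\<lambda>k. inverse (fact k) * 1 ^ k :: real) = (\<lambda>k. real (Suc k) / fact (Suc k))"
      by (simp add: fun_eq_iff divide_simps del: of_nat_Suc)
    finally show "(\<lambda>k. real (Suc k) / fact (Suc k)) \<longlonglongrightarrow> 0" .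
  qed
  then have lim: "(\<lambda>n. real (block n) / fact (block n)) \<longlonglongrightarrow> 0"
    by (rule filterlim_compose[OF _ filterlim_block])
  have bound: "real (block n) / real n \<le> real (block n) / fact (block n)" for n
  proof (cases "block n = 0")
    case False
    then have "(fact (block n) :: nat) \<le> n"
      using fact_block_le by simp
    then have le: "(fact (block n) :: real) \<le> real n"
      by (metis of_nat_fact of_nat_le_iff)
    then have "0 < real n"
      by (rule less_le_trans[OF fact_gt_zero])
    with le show ?thesis
      by (intro divide_left_mono mult_pos_pos) simp_all
  qed simp
  show ?thesis
    by (rule tendsto_sandwich[OF _ _ tendsto_const lim]) (auto simp: bound)
qed

text \<open>Up to the end of block \<open>k\<close>, the earlier blocks contribute at most \<open>k! / (k+1)!\<close> to the average
  of a function bounded by \<open>1\<close>; at the ends of the blocks in \<open>K\<close> the average of \<open>g\<close> is therefore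
  controlled by that of \<open>w\<close>.\<close>

lemma avg_tendsto_0_at_block_ends:
  fixes g w :: "nat \<Rightarrow> real"
  assumes K: "infinite K"
    and g01: "\<And>i. 0 \<le> g i" "\<And>i. g i \<le> 1"
    and w0: "\<And>i. 0 \<le> w i"
    and gw: "\<And>i. block i \<in> K \<Longrightarrow> g i \<le> w i"
    and w: "avg w \<longlonglongrightarrow> 0"
  obtains r :: "nat \<Rightarrow> nat" where "strict_mono r" "\<And>j. 0 < r j" "(\<lambda>j. avg g (r j)) \<longlonglongrightarrow> 0"
proof
  let ?e = "enumerate K"
  let ?r = "\<lambda>j. fact (Suc (?e j)) :: nat"
  have e: "strict_mono ?e"
    using K by (simp add: strict_mono_enumerate)
  show r: "strict_mono ?r"
    using e by (auto simp: strict_mono_def intro!: fact_less_mono_nat simp del: fact_Suc)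
  show "0 < ?r j" for j by (rule fact_gt_zero)
  have bound: "avg g (?r j) \<le> avg w (?r j) + inverse (real (Suc (?e j)))" for j
  proof -
    let ?k = "?e j"
    have split: "{..<fact (Suc ?k)} = {..<fact ?k} \<union> {fact ?k..<fact (Suc ?k) :: nat}"
      using fact_mono_nat[of ?k "Suc ?k"] by auto
    have "(\<Sum>i<?r j. g i) = (\<Sum>i<fact ?k. g i) + (\<Sum>i=fact ?k..<fact (Suc ?k). g i)"
      unfolding split by (rule sum.union_disjoint) auto
    also have "\<dots> \<le> (\<Sum>i\<in>{..<fact ?k :: nat}. 1) + (\<Sum>i=fact ?k..<fact (Suc ?k). w i)"
    proof (intro add_mono sum_mono)
      fix i :: nat assume "i \<in> {fact ?k..<fact (Suc ?k)}"
      then have "block i = ?k" by (intro block_eq) auto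
      then show "g i \<le> w i"
        using gw enumerate_in_set[OF K] by simp
    qed (rule g01)
    also have "\<dots> \<le> fact ?k + (\<Sum>i<?r j. w i)"
      by (intro add_mono sum_mono2) (auto intro: w0)
    finally have "avg g (?r j) \<le> 1 / real (?r j) * (fact ?k + (\<Sum>i<?r j. w i))"
      by (intro mult_left_mono) auto
    also have "\<dots> = avg w (?r j) + fact ?k / fact (Suc ?k)"
      unfolding distrib_left by (simp del: fact_Suc)
    also have "fact ?k / fact (Suc ?k) = inverse (real (Suc ?k))"
      unfolding fact_Suc[of ?k] by (simp add: inverse_eq_divide del: of_nat_Suc)
    finally show ?thesis .
  qed
  have "(\<lambda>j. avg w (?r j) + inverse (real (Suc (?e j)))) \<longlonglongrightarrow> 0 + 0"
  proof (rule tendsto_add)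
    show "(\<lambda>j. avg w (?r j)) \<longlonglongrightarrow> 0"
      using LIMSEQ_subseq_LIMSEQ[OF w r] by (simp add: o_def)
    show "(\<lambda>j. inverse (real (Suc (?e j)))) \<longlonglongrightarrow> 0"
      using LIMSEQ_subseq_LIMSEQ[OF LIMSEQ_inverse_real_of_nat e] by (simp add: o_def)
  qed
  then have lim: "(\<lambda>j. avg w (?r j) + inverse (real (Suc (?e j)))) \<longlonglongrightarrow> 0"
    unfolding add_0_left .
  have nonneg: "0 \<le> avg g (?r j)" for j
    by (intro mult_nonneg_nonneg sum_nonneg g01) auto
  show "(\<lambda>j. avg g (?r j)) \<longlonglongrightarrow> 0"
    by (rule tendsto_sandwich[OF always_eventually always_eventually tendsto_const lim])
       (intro allI nonneg bound)+
qed

section \<open>Pseudo-orbits that switch between two orbits\<close>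

lemma comp_maps_in:
  assumes "\<And>n. f n ` X \<subseteq> X" "x \<in> X"
  shows "comp_maps f n x \<in> X"
  using assms by (induction n) auto

text \<open>A switch can only happen where \<open>block\<close> jumps, so the error at time \<open>i\<close> is at most
  \<open>C * (block (i + 1) - block i)\<close>, with \<open>C\<close> bounding the diameter of \<open>X\<close>. These bounds telescope.\<close>

lemma avg_error_of_orbit_switching:
  fixes X :: "'a::metric_space set"
  assumes X: "bounded X" "\<And>n. f n ` X \<subseteq> X" and z: "\<And>k. z k \<in> X"
  shows "asymp_avg_pseudo_orbit X f (\<lambda>n. comp_maps f n (z (block n)))"
  unfolding asymp_avg_pseudo_orbit_def
proof (intro conjI allI)
  show in_X: "comp_maps f n (z (block n)) \<in> X" for n
    using X(2) z by (rule comp_maps_in)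
  obtain C where C: "\<And>x y. x \<in> X \<Longrightarrow> y \<in> X \<Longrightarrow> dist x y \<le> C"
    using X(1) bounded_two_points by metis
  let ?err = "\<lambda>i. dist (f i (comp_maps f i (z (block i)))) (comp_maps f (Suc i) (z (block (Suc i))))"
  have C0: "0 \<le> C"
    using C[OF z z, of 0 0] by simp
  have err: "?err i \<le> C * (real (block (Suc i)) - real (block i))" for i
  proof (cases "block (Suc i) = block i")
    case False
    then have "block i < block (Suc i)"
      using block_mono[of i "Suc i"] by simp
    then have "C * 1 \<le> C * (real (block (Suc i)) - real (block i))"
      using C0 by (intro mult_left_mono) auto
    moreover have "?err i \<le> C"
      using X(2) in_X[of i] in_X[of "Suc i"] by (intro C) auto
    ultimately show ?thesis by simp
  qed simp
  have bound: "avg ?err n \<le> C * (real (block n) / real n)" for n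
  proof -
    have "(\<Sum>i<n. ?err i) \<le> (\<Sum>i<n. C * (real (block (Suc i)) - real (block i)))"
      by (intro sum_mono err)
    also have "\<dots> = C * (real (block n) - real (block 0))"
      unfolding sum_distrib_left[symmetric] by (simp only: sum_lessThan_telescope[of "\<lambda>i. real (block i)"])
    also have "\<dots> \<le> C * real (block n)"
      using C0 by (intro mult_left_mono) auto
    finally show ?thesis
      by (cases "n = 0") (auto simp: divide_simps mult.commute)
  qed
  have nonneg: "0 \<le> avg ?err n" for n
    by (intro mult_nonneg_nonneg sum_nonneg) auto
  have lim: "(\<lambda>n. C * (real (block n) / real n)) \<longlonglongrightarrow> 0"
    using tendsto_mult_right_zero[OF block_over_time_tendsto_0] .
  show "avg ?err \<longlonglongrightarrow> 0"
    by (rule tendsto_sandwich[OF always_eventually always_eventually tendsto_const lim])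
       (intro allI nonneg bound)+
qed

lemma finite_orbit_of_periodic_point:
  assumes "periodic_point X f x"
  shows "finite (sys_orbit f x)"
proof -
  obtain k where k: "k \<ge> 1" "\<And>n. comp_maps f (n + k) x = comp_maps f n x"
    using assms unfolding periodic_point_def by auto
  have "comp_maps f n x \<in> (\<lambda>n. comp_maps f n x) ` {..<k}" for n
  proof (induction n rule: less_induct)
    case (less n)
    show ?case
    proof (cases "n < k")
      case False
      then show ?thesis
        using less[of "n - k"] k(1) k(2)[of "n - k"] by simp
    qed auto
  qed
  then have "sys_orbit f x \<subseteq> (\<lambda>n. comp_maps f n x) ` {..<k}"
    unfolding sys_orbit_def by auto
  then show ?thesis
    by (rule finite_subset) simp
qed

lemma finite_disjoint_imp_separated:
  fixes A B :: "'a::metric_space set"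
  assumes "finite A" "finite B" "A \<inter> B = {}"
  obtains d where "d > 0" "\<And>x y. x \<in> A \<Longrightarrow> y \<in> B \<Longrightarrow> d \<le> dist x y"
proof
  let ?D = "insert 1 ((\<lambda>(x, y). dist x y) ` (A \<times> B))"
  have fin: "finite ?D"
    using assms by simp
  show "Min ?D > 0"
    using assms fin by (subst Min_gr_iff) auto
  show "Min ?D \<le> dist x y" if "x \<in> A" "y \<in> B" for x y
    using that fin by (intro Min_le) force+
qed

section \<open>Upper and lower distribution functions along subsequences\<close>

lemma close_freq_le_1: "close_freq f x y e n \<le> 1"
proof -
  have "(\<Sum>i<n. indicator {0..<e} (dist (comp_maps f i x) (comp_maps f i y))) \<le> (\<Sum>i<n. 1 :: real)"
    by (intro sum_mono) (auto simp: indicator_def)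
  then show ?thesis
    unfolding close_freq_def by (cases "n = 0") (auto simp: field_simps)
qed

lemma close_freq_nonneg: "0 \<le> close_freq f x y e n"
  unfolding close_freq_def by (intro mult_nonneg_nonneg sum_nonneg) auto

lemma upper_dist_fun_eq_1:
  assumes r: "strict_mono r" and lim: "(\<lambda>j. close_freq f x y e (r j)) \<longlonglongrightarrow> 1"
  shows "upper_dist_fun f x y e = 1"
proof (rule antisym)
  let ?c = "\<lambda>n. ereal (close_freq f x y e n)"
  show "upper_dist_fun f x y e \<le> 1"
    unfolding upper_dist_fun_def by (intro Limsup_bounded) (simp add: close_freq_le_1)
  have "(?c \<circ> r) \<longlonglongrightarrow> 1"
    using lim by (simp add: o_def one_ereal_def)
  then have "limsup (?c \<circ> r) = 1"
    by (intro lim_imp_Limsup) auto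
  then show "1 \<le> upper_dist_fun f x y e"
    unfolding upper_dist_fun_def using limsup_subseq_mono[OF r, of ?c] by simp
qed

lemma lower_dist_fun_eq_0:
  assumes r: "strict_mono r" and lim: "(\<lambda>j. close_freq f x y e (r j)) \<longlonglongrightarrow> 0"
  shows "lower_dist_fun f x y e = 0"
proof (rule antisym)
  let ?c = "\<lambda>n. ereal (close_freq f x y e n)"
  show "0 \<le> lower_dist_fun f x y e"
    unfolding lower_dist_fun_def by (intro Liminf_bounded) (simp add: close_freq_nonneg)
  have "(?c \<circ> r) \<longlonglongrightarrow> 0"
    using lim by (simp add: o_def zero_ereal_def)
  then have "liminf (?c \<circ> r) = 0"
    by (intro lim_imp_Liminf) auto
  then show "lower_dist_fun f x y e \<le> 0"
    unfolding lower_dist_fun_def using liminf_subseq_mono[OF r, of ?c] by simp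
qed

lemma lower_dist_fun_self:
  assumes "e > 0"
  shows "lower_dist_fun f x x e = 1"
proof -
  have "close_freq f x x e n = 1" if "n \<ge> 1" for n
    using that assms by (simp add: close_freq_def)
  then have "eventually (\<lambda>n. 1 = ereal (close_freq f x x e n)) sequentially"
    by (auto simp: eventually_sequentially one_ereal_def)
  then have "(\<lambda>n. ereal (close_freq f x x e n)) \<longlonglongrightarrow> 1"
    by (rule Lim_transform_eventually[OF tendsto_const])
  then show ?thesis
    unfolding lower_dist_fun_def by (intro lim_imp_Liminf) auto
qed

text \<open>The last two results of this section are where shadowing in average is used: distances between
  true orbits and between pseudo-orbits differ by at most the sum of the two shadowing errors, and
  by Markov's inequality the frequency of times at which that sum reaches \<open>e\<close> is at most its average
  over \<open>e\<close>.\<close>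

lemma avg_shadowing_errors:
  assumes "asymp_shadowed_in_avg f u x" "asymp_shadowed_in_avg f v y"
  shows "avg (\<lambda>i. (dist (comp_maps f i x) (u i) + dist (comp_maps f i y) (v i)) / e) \<longlonglongrightarrow> 0"
proof -
  have "(\<lambda>n. avg (\<lambda>i. dist (comp_maps f i x) (u i)) n
            + avg (\<lambda>i. dist (comp_maps f i y) (v i)) n) \<longlonglongrightarrow> 0 + 0"
    using assms unfolding asymp_shadowed_in_avg_def by (rule tendsto_add)
  then have "(\<lambda>n. (avg (\<lambda>i. dist (comp_maps f i x) (u i)) n
            + avg (\<lambda>i. dist (comp_maps f i y) (v i)) n) / e) \<longlonglongrightarrow> 0"
    by (intro tendsto_divide_zero) simp
  then show ?thesis
    by (simp only: sum.distrib sum_divide_distrib[symmetric] distrib_left[symmetric]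
        times_divide_eq_right)
qed

lemma upper_dist_fun_eq_1_if_pseudo_orbits_agree:
  fixes e :: real
  assumes sh: "asymp_shadowed_in_avg f u x" "asymp_shadowed_in_avg f v y"
    and K: "infinite K" "\<And>i. block i \<in> K \<Longrightarrow> u i = v i" and e: "e > 0"
  shows "upper_dist_fun f x y e = 1"
proof -
  let ?d = "\<lambda>i. dist (comp_maps f i x) (comp_maps f i y)"
  let ?w = "\<lambda>i. (dist (comp_maps f i x) (u i) + dist (comp_maps f i y) (v i)) / e"
  let ?far = "\<lambda>i. 1 - indicator {0..<e} (?d i) :: real"
  have far_le: "?far i \<le> ?w i" if "block i \<in> K" for i
  proof -
    have "?d i \<le> dist (comp_maps f i x) (u i) + dist (comp_maps f i y) (v i)"
      using K(2)[OF that] dist_triangle2 by metis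
    then show ?thesis
      using e by (auto simp: indicator_def field_simps)
  qed
  obtain r where r: "strict_mono r" "\<And>j. 0 < r j" and lim: "(\<lambda>j. avg ?far (r j)) \<longlonglongrightarrow> 0"
  proof (rule avg_tendsto_0_at_block_ends[of K ?far ?w])
    show "avg ?w \<longlonglongrightarrow> 0"
      using sh by (rule avg_shadowing_errors)
  qed (use K(1) e far_le in \<open>auto simp: indicator_def\<close>)
  have "close_freq f x y e (r j) = 1 - avg ?far (r j)" for j
    using r(2)[of j] by (simp add: close_freq_def sum_subtractf field_simps)
  then have "(\<lambda>j. close_freq f x y e (r j)) \<longlonglongrightarrow> 1"
    using tendsto_diff[OF tendsto_const lim, of 1] by simp
  with r(1) show ?thesis
    by (rule upper_dist_fun_eq_1)
qed

lemma lower_dist_fun_eq_0_if_pseudo_orbits_apart: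
  fixes e :: real
  assumes sh: "asymp_shadowed_in_avg f u x" "asymp_shadowed_in_avg f v y"
    and K: "infinite K" "\<And>i. block i \<in> K \<Longrightarrow> 2 * e \<le> dist (u i) (v i)" and e: "e > 0"
  shows "lower_dist_fun f x y e = 0"
proof -
  let ?d = "\<lambda>i. dist (comp_maps f i x) (comp_maps f i y)"
  let ?w = "\<lambda>i. (dist (comp_maps f i x) (u i) + dist (comp_maps f i y) (v i)) / e"
  let ?near = "\<lambda>i. indicator {0..<e} (?d i) :: real"
  have near_le: "?near i \<le> ?w i" if "block i \<in> K" for i
  proof -
    have "dist (u i) (v i) \<le> dist (comp_maps f i x) (u i) + ?d i + dist (comp_maps f i y) (v i)"
      by (smt (verit) dist_commute dist_triangle)
    then show ?thesis
      using e K(2)[OF that] by (auto simp: indicator_def field_simps)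
  qed
  obtain r where r: "strict_mono r" "\<And>j. 0 < r j" and lim: "(\<lambda>j. avg ?near (r j)) \<longlonglongrightarrow> 0"
  proof (rule avg_tendsto_0_at_block_ends[of K ?near ?w])
    show "avg ?w \<longlonglongrightarrow> 0"
      using sh by (rule avg_shadowing_errors)
  qed (use K(1) e near_le in \<open>auto simp: indicator_def\<close>)
  from lim have "(\<lambda>j. close_freq f x y e (r j)) \<longlonglongrightarrow> 0"
    by (simp add: close_freq_def)
  with r(1) show ?thesis
    by (rule lower_dist_fun_eq_0)
qed

section \<open>Uncountably many choices of orbits\<close>

text \<open>Even blocks are a common ground on which all choices agree. The first component of
  \<^const>\<open>prod_decode\<close> takes every value infinitely often, so block \<open>2 * j + 1\<close> can use it to select
  the natural whose membership in \<open>a\<close> is queried.\<close>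

definition picks_p :: "nat set \<Rightarrow> nat \<Rightarrow> bool" where
  "picks_p a k \<longleftrightarrow> odd k \<and> fst (prod_decode (k div 2)) \<in> a"

lemma infinite_even: "infinite {k :: nat. even k}"
proof -
  have "range (\<lambda>m :: nat. 2 * m) \<subseteq> {k. even k}" by auto
  moreover have "infinite (range (\<lambda>m :: nat. 2 * m))"
    by (intro range_inj_infinite) (simp add: inj_def)
  ultimately show ?thesis
    by (rule infinite_super)
qed

lemma infinite_choices_differ:
  assumes "a \<noteq> b"
  shows "infinite {k. picks_p a k \<noteq> picks_p b k}"
proof -
  obtain m where m: "m \<in> a \<longleftrightarrow> m \<notin> b"
    using assms by blast
  let ?k = "\<lambda>j. 2 * prod_encode (m, j) + 1"
  have "range ?k \<subseteq> {k. picks_p a k \<noteq> picks_p b k}"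
    using m by (auto simp: picks_p_def)
  moreover have "infinite (range ?k)"
    by (intro range_inj_infinite) (simp add: inj_def)
  ultimately show ?thesis
    by (rule infinite_super)
qed

lemma uncountable_nat_sets: "uncountable (UNIV :: nat set set)"
proof
  assume "countable (UNIV :: nat set set)"
  then have "range (from_nat_into UNIV) = (UNIV :: nat set set)"
    by (intro range_from_nat_into) auto
  then show False
    using Cantors_theorem[of "UNIV :: nat set"] by (metis Pow_UNIV)
qed

text \<open>Each choice is realised by the point that shadows its pseudo-orbit. The scrambling of any two of
  these points includes that they are distinct, as lower distribution function \<open>0\<close> is impossible for
  a point paired with itself; so there are uncountably many of them.\<close>

theorem theorem4p4:
  fixes X :: "'a::metric_space set" and f :: "nat \<Rightarrow> 'a \<Rightarrow> 'a"
  assumes "compact X"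
    and "\<And>n. f n ` X \<subseteq> X"
    and "\<And>n. continuous_on X (f n)"
    and "\<exists>p q. periodic_point X f p \<and> periodic_point X f q \<and> sys_orbit f p \<inter> sys_orbit f q = {}"
    and "asymp_avg_shadowing_property X f"
  shows "\<exists>\<delta>>0. dist_chaotic X f \<delta>"
proof -
  obtain p q where p: "periodic_point X f p" and q: "periodic_point X f q"
    and disj: "sys_orbit f p \<inter> sys_orbit f q = {}"
    using assms(4) by auto
  obtain d where d: "d > 0" "\<And>x y. x \<in> sys_orbit f p \<Longrightarrow> y \<in> sys_orbit f q \<Longrightarrow> d \<le> dist x y"
    using finite_disjoint_imp_separated[OF finite_orbit_of_periodic_point[OF p]
        finite_orbit_of_periodic_point[OF q] disj] by metis
  define u where "u a n = comp_maps f n (if picks_p a (block n) then p else q)" for a n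
  have "asymp_avg_pseudo_orbit X f (u a)" for a
    unfolding u_def
    using avg_error_of_orbit_switching[of X f "\<lambda>k. if picks_p a k then p else q"]
      compact_imp_bounded[OF assms(1)] assms(2) p q by (simp add: periodic_point_def)
  then have "\<forall>a. \<exists>y. y \<in> X \<and> asymp_shadowed_in_avg f (u a) y"
    using assms(5) unfolding asymp_avg_shadowing_property_def by blast
  then obtain y where yX: "\<And>a. y a \<in> X" and y: "\<And>a. asymp_shadowed_in_avg f (u a) (y a)"
    by metis

  (* Half the distance of the orbits: the other half absorbs the shadowing errors. *)
  define \<delta> where "\<delta> = d / 2"
  have \<delta>: "\<delta> > 0"
    using d(1) by (simp add: \<delta>_def)
  have upper: "upper_dist_fun f (y a) (y b) e = 1" if "e > 0" for a b e
    by (rule upper_dist_fun_eq_1_if_pseudo_orbits_agree[OF y y infinite_even _ that])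
       (simp add: u_def picks_p_def)
  have lower: "lower_dist_fun f (y a) (y b) \<delta> = 0" if "a \<noteq> b" for a b
  proof (rule lower_dist_fun_eq_0_if_pseudo_orbits_apart[OF y y infinite_choices_differ[OF that] _ \<delta>])
    fix i assume "block i \<in> {k. picks_p a k \<noteq> picks_p b k}"
    moreover have "d \<le> dist (comp_maps f i p) (comp_maps f i q)"
      by (rule d(2)) (auto simp: sys_orbit_def)
    ultimately show "2 * \<delta> \<le> dist (u a i) (u b i)"
      by (auto simp: u_def \<delta>_def dist_commute)
  qed
  have inj: "inj y"
  proof (rule injI, rule ccontr)
    fix a b assume "y a = y b" "a \<noteq> b"
    then show False
      using lower[of a b] lower_dist_fun_self[OF \<delta>, of f "y a"] by simp
  qed
  have "dist_scrambled X f \<delta> (range y)"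
    unfolding dist_scrambled_def
  proof (intro conjI)
    show "range y \<subseteq> X"
      using yX by auto
    have "y {} \<noteq> y UNIV"
      using inj by (auto dest: injD)
    then show "\<exists>x\<in>range y. \<exists>z\<in>range y. x \<noteq> z"
      by blast
    show "\<forall>x\<in>range y. \<forall>z\<in>range y. x \<noteq> z \<longrightarrow>
        (\<forall>e>0. upper_dist_fun f x z e = 1) \<and> lower_dist_fun f x z \<delta> = 0"
      using upper lower by (metis rangeE)
  qed
  moreover have "uncountable (range y)"
    using uncountable_nat_sets inj by (simp add: countable_image_inj_eq)
  ultimately show ?thesis
    using \<delta> unfolding dist_chaotic_def by blast
qed

end
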